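(* Let $\Bbbk$ be a commutative ring and let $\mathcal{P}=\bigoplus_{n\ge0}\Bbbk P_n$ be the Hopf algebra of uniform block permutations. The graded subspace $\mathcal{S}=\bigoplus_{n\ge0}\Bbbk S_n$ of $\mathcal{P}$, spanned by the permutations (viewed as the uniform block permutations all of whose blocks have cardinality $1$), is a Hopf subalgebra of $\mathcal{P}$.
   Context: **Uniform block permutations.** For $n\ge 0$ let $[n]=\{1,\dots,n\}$. A set partition of $[n]$ is a collection of non-empty disjoint subsets (blocks) of $[n]$ with union $[n]$. A uniform block permutation of $[n]$ is a bijection $f:\mathcal{A}\to\mathcal{B}$ between two set partitions of $[n]$ such that $|f(A)|=|A|$ for every $A\in\mathcal{A}$; $\mathcal A$ is its domain and $\mathcal B$ its codomain. $P_n$ is the (finite) set of uniform block permutations of $[n]$; $P_0=\{\emptyset\}$, where $\emptyset$ denotes the empty uniform block permutation. **Monoid structure.** For $f:\mathcal{A}\to\mathcal{B}$ and $g:\mathcal{C}\to\mathcal{D}$ in $P_n$, the product $g\cdot f$ ("first $f$, then $g$") is defined as follows: let $\mathcal{E}$ be the finest set partition of $[n]$ such that every block of $\mathcal{B}$ and every block of $\mathcal{C}$ is contained in a block of $\mathcal{E}$; for each $E\in\mathcal{E}$, $g\cdot f$ has the domain block $\bigcup\{f^{-1}(B): B\in\mathcal{B}, B\subseteq E\}$ and sends it to $\bigcup\{g(C): C\in\mathcal{C}, C\subseteq E\}$. A permutation $\sigma\in S_n$ is identified with the uniform block permutation $\{i\}\mapsto\{\sigma(i)\}$; thus $S_n$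 is a submonoid of $P_n$. $\Bbbk P_n$ is the monoid algebra (free $\Bbbk$-module on $P_n$, product extended bilinearly). **Concatenation.** For $f\in P_n$, $g\in P_m$, $f\times g\in P_{n+m}$ is the uniform block permutation whose domain blocks are the domain blocks $A$ of $f$, with $A\mapsto f(A)$, and the sets $A'+n=\{a+n: a\in A'\}$ for $A'$ a domain block of $g$, with $A'+n\mapsto g(A')+n$. **The Hopf algebra $\mathcal{P}$.** An $(n,m)$-shuffle is $\xi\in S_{n+m}$ with $\xi(1)<\cdots<\xi(n)$ and $\xi(n+1)<\cdots<\xi(n+m)$. $\mathrm{Sh}(n,m)$ is the set of these and $sh_{n,m}=\sum_{\xi\in \mathrm{Sh}(n,m)}\xi$. The product of $\mathcal{P}$ is $f\ast g=sh_{n,m}\cdot(f\times g)$ for $f\in P_n$, $g\in P_m$, extended bilinearly. A breaking point of a set partition $\mathcal{B}$ of $[n]$ is $i\in\{0,\dots,n\}$ such that $\{1,\dots,i\}$ is a union of blocks of $\mathcal{B}$; for $f:\mathcal{A}\to\mathcal{B}$, $B(f)$ is the set of breaking points of $\mathcal{B}$. For each $i\in B(f)$ there are a unique $\xi\in\mathrm{Sh}(i,n-i)$ and unique $f_{(i)}\in P_i$, $f'_{(n-i)}\in P_{n-i}$ with $f=(f_{(i)}\times f'_{(n-i)})\cdot\xi^{-1}$. The coproduct is $\Delta(f)=\sum_{i\in B(f)}f_{(i)}\otimes f'_{(n-i)}$. The unit is $\emptyset$; the counit is $\varepsilon(\emptyset)=1$, $\varepsilon(f)=0$ for $f\in P_n$,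 $n\ge1$. With the grading in which $\Bbbk P_n$ has degree $n$, this is a graded connected Hopf algebra. *)

theory Defs
  imports
    Complex_Main
    "HOL-Library.Poly_Mapping"
    "HOL-Library.Disjoint_Sets"
    "HOL-Combinatorics.Permutations"
begin

section \<open>Uniform block permutations\<close>

text \<open>A uniform block permutation \<open>f\<close> from \<open>\<A>\<close> to \<open>\<B>\<close> is represented by its graph, the set of
  pairs \<open>(A, f(A))\<close>; thus \<open>\<A>\<close> is its \<open>Domain\<close> and \<open>\<B>\<close> its \<open>Range\<close>.\<close>

definition is_ubp :: "nat \<Rightarrow> (nat set \<times> nat set) set \<Rightarrow> bool" where
  "is_ubp n f \<longleftrightarrow>
     partition_on {1..n} (Domain f) \<and> partition_on {1..n} (Range f) \<and>
     single_valued f \<and> single_valued (f\<inverse>) \<and> (\<forall>(A, B)\<in>f. card B = card A)"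

definition raw_degree :: "(nat set \<times> nat set) set \<Rightarrow> nat" where
  "raw_degree f = card (\<Union>(Domain f))"

definition partition_join :: "nat \<Rightarrow> nat set set \<Rightarrow> nat set set \<Rightarrow> nat set set" where
  "partition_join n \<B> \<C> =
     (THE \<E>. refines {1..n} \<B> \<E> \<and> refines {1..n} \<C> \<E> \<and>
       (\<forall>\<E>'. refines {1..n} \<B> \<E>' \<and> refines {1..n} \<C> \<E>' \<longrightarrow> refines {1..n} \<E> \<E>'))"

text \<open>The product \<open>g \<cdot> f\<close> in \<open>P\<^sub>n\<close> (first \<open>f\<close>, then \<open>g\<close>).\<close>

definition raw_comp :: "nat \<Rightarrow> (nat set \<times> nat set) set \<Rightarrow> (nat set \<times> nat set) set
    \<Rightarrow> (nat set \<times> nat set) set" where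
  "raw_comp n g f =
     (\<lambda>E. (\<Union>{A | A B. (A, B) \<in> f \<and> B \<subseteq> E}, \<Union>{D | C D. (C, D) \<in> g \<and> C \<subseteq> E}))
       ` partition_join n (Range f) (Domain g)"

definition raw_cat :: "(nat set \<times> nat set) set \<Rightarrow> (nat set \<times> nat set) set
    \<Rightarrow> (nat set \<times> nat set) set" where
  "raw_cat f g =
     f \<union> (\<lambda>(A, B). ((+) (raw_degree f) ` A, (+) (raw_degree f) ` B)) ` g"

definition raw_perm :: "nat \<Rightarrow> (nat \<Rightarrow> nat) \<Rightarrow> (nat set \<times> nat set) set" where
  "raw_perm n \<sigma> = (\<lambda>i. ({i}, {\<sigma> i})) ` {1..n}"

lemma is_ubp_empty: "is_ubp 0 {}"
  by (simp add: is_ubp_def partition_on_def)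

lemma is_ubp_converse: "is_ubp n f \<Longrightarrow> is_ubp n (f\<inverse>)"
  by (auto simp: is_ubp_def)

lemma raw_degree_eq: "is_ubp n f \<Longrightarrow> raw_degree f = n"
  by (auto simp: is_ubp_def raw_degree_def partition_on_def)

lemma partition_join_unique_exists:
  fixes n :: nat
  assumes "partition_on {1..n} \<B>" "partition_on {1..n} \<C>"
  shows "\<exists>!\<E>. refines {1..n} \<B> \<E> \<and> refines {1..n} \<C> \<E> \<and>
       (\<forall>\<E>'. refines {1..n} \<B> \<E>' \<and> refines {1..n} \<C> \<E>' \<longrightarrow> refines {1..n} \<E> \<E>')"
proof -
  let ?U = "{\<E>. refines {1..n} \<B> \<E> \<and> refines {1..n} \<C> \<E>}"
  have part: "partition_on {1..n} \<E>" if "\<E> \<in> ?U" for \<E>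
    using that by (auto simp: refines_def)
  have ne: "?U \<noteq> {}"
  proof (cases "n = 0")
    case True
    then have "\<B> = {}" "\<C> = {}"
      using assms by (auto simp: partition_on_def)
    then have "{} \<in> ?U"
      using True by (simp add: refines_def partition_on_def)
    then show ?thesis by blast
  next
    case False
    then have "partition_on {1..n} {{1..n}}"
      by (intro partition_on_space) auto
    moreover have "\<forall>X\<in>\<B>. X \<subseteq> {1..n}" "\<forall>X\<in>\<C>. X \<subseteq> {1..n}"
      using assms by (auto simp: partition_on_def)
    ultimately have "{{1..n}} \<in> ?U"
      using assms by (simp add: refines_def)
    then show ?thesis by blast
  qed
  let ?E = "common_refinement ?U"
  have 1: "refines {1..n} \<B> ?E"
    by (rule common_refinement_coarsest) (use assms part ne in auto)
  have 2: "refines {1..n} \<C> ?E"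
    by (rule common_refinement_coarsest) (use assms part ne in auto)
  have 3: "refines {1..n} ?E \<E>'" if "\<E>' \<in> ?U" for \<E>'
    by (rule refines_common_refinement) (use part that in auto)
  show ?thesis
  proof (rule ex1I[of _ ?E])
    show "refines {1..n} \<B> ?E \<and> refines {1..n} \<C> ?E \<and>
       (\<forall>\<E>'. refines {1..n} \<B> \<E>' \<and> refines {1..n} \<C> \<E>' \<longrightarrow> refines {1..n} ?E \<E>')"
      using 1 2 3 by blast
  next
    fix \<E>
    assume E: "refines {1..n} \<B> \<E> \<and> refines {1..n} \<C> \<E> \<and>
       (\<forall>\<E>'. refines {1..n} \<B> \<E>' \<and> refines {1..n} \<C> \<E>' \<longrightarrow> refines {1..n} \<E> \<E>')"
    then have "refines {1..n} \<E> ?E" using 1 2 by blast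
    moreover have "refines {1..n} ?E \<E>" using 3 E by blast
    ultimately show "\<E> = ?E" by (rule refines_asym)
  qed
qed

lemma partition_join:
  fixes n :: nat
  assumes "partition_on {1..n} \<B>" "partition_on {1..n} \<C>"
  shows "refines {1..n} \<B> (partition_join n \<B> \<C>)"
    and "refines {1..n} \<C> (partition_join n \<B> \<C>)"
    and "refines {1..n} \<B> \<E>' \<Longrightarrow> refines {1..n} \<C> \<E>' \<Longrightarrow>
           refines {1..n} (partition_join n \<B> \<C>) \<E>'"
  using theI'[OF partition_join_unique_exists[OF assms], folded partition_join_def] by auto

lemma disjoint_block_eq:
  "disjoint P \<Longrightarrow> p \<in> P \<Longrightarrow> q \<in> P \<Longrightarrow> x \<in> p \<Longrightarrow> x \<in> q \<Longrightarrow> p = q"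
  by (auto simp: pairwise_def disjnt_def)

lemma is_ubp_coarsen:
  assumes f: "is_ubp n f" and ref: "refines {1..n} (Range f) \<E>"
  defines "X \<equiv> \<lambda>E. \<Union>{A | A B. (A, B) \<in> f \<and> B \<subseteq> E}"
  shows "partition_on {1..n} (X ` \<E>)" "inj_on X \<E>" "\<And>E. E \<in> \<E> \<Longrightarrow> card (X E) = card E"
proof -
  have E: "\<Union>\<E> = {1..n}" "disjoint \<E>" "{} \<notin> \<E>"
    using ref by (auto simp: refines_def partition_on_def)
  have D: "\<Union>(Domain f) = {1..n}" "disjoint (Domain f)" "{} \<notin> Domain f"
    and R: "\<Union>(Range f) = {1..n}" "disjoint (Range f)" "{} \<notin> Range f"
    and sv: "single_valued f" "single_valued (f\<inverse>)"
    and cd: "\<And>A B. (A, B) \<in> f \<Longrightarrow> card B = card A"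
    using f by (auto simp: is_ubp_def partition_on_def)
  have sub: "\<exists>E\<in>\<E>. B \<subseteq> E" if "(A, B) \<in> f" for A B
    using ref that by (auto simp: refines_def)
  have full: "\<Union>{B | A B. (A, B) \<in> f \<and> B \<subseteq> E} = E" if "E \<in> \<E>" for E
  proof
    show "E \<subseteq> \<Union>{B | A B. (A, B) \<in> f \<and> B \<subseteq> E}"
    proof
      fix x assume x: "x \<in> E"
      then have "x \<in> \<Union>(Range f)" using E R that by auto
      then obtain A B where AB: "(A, B) \<in> f" "x \<in> B" by auto
      then obtain E' where "E' \<in> \<E>" "B \<subseteq> E'" using sub by blast
      moreover have "E' = E"
        using disjoint_block_eq[OF E(2) _ that _ x] calculation AB by blast
      ultimately show "x \<in> \<Union>{B | A B. (A, B) \<in> f \<and> B \<subseteq> E}" using AB by blast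
    qed
  qed auto
  have meet: "E = E'" if mt: "E \<in> \<E>" "E' \<in> \<E>" "x \<in> X E" "x \<in> X E'" for E E' x
  proof -
    obtain A B where AB: "(A, B) \<in> f" "B \<subseteq> E" "x \<in> A" using mt(3) unfolding X_def by blast
    obtain A' B' where AB': "(A', B') \<in> f" "B' \<subseteq> E'" "x \<in> A'" using mt(4) unfolding X_def by blast
    have "A = A'" using disjoint_block_eq[OF D(2) _ _ AB(3) AB'(3)] AB(1) AB'(1) by blast
    then have "B = B'" using single_valuedD[OF sv(1)] AB(1) AB'(1) by blast
    moreover obtain y where "y \<in> B" using R(3) AB by fastforce
    ultimately show "E = E'" using disjoint_block_eq[OF E(2) mt(1,2)] AB AB' by blast
  qed
  have ne: "X E \<noteq> {}" if "E \<in> \<E>" for E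
  proof -
    have "E \<noteq> {}" using that E(3) by auto
    then obtain A B where "(A, B) \<in> f" "B \<subseteq> E" using full[OF \<open>E \<in> \<E>\<close>] by blast
    moreover have "A \<noteq> {}" using calculation D(3) by auto
    ultimately show ?thesis unfolding X_def by blast
  qed
  show "inj_on X \<E>"
    by (rule inj_onI) (metis meet ne ex_in_conv)
  show "partition_on {1..n} (X ` \<E>)"
  proof (rule partition_onI)
    show "\<Union>(X ` \<E>) = {1..n}"
    proof
      show "\<Union>(X ` \<E>) \<subseteq> {1..n}" unfolding D(1)[symmetric] X_def by blast
      show "{1..n} \<subseteq> \<Union>(X ` \<E>)"
      proof
        fix x assume "x \<in> {1..n}"
        then have "x \<in> \<Union>(Domain f)" using D(1) by simp
        then obtain A B where AB: "(A, B) \<in> f" "x \<in> A" by auto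
        then obtain E where "E \<in> \<E>" "B \<subseteq> E" using sub by blast
        then show "x \<in> \<Union>(X ` \<E>)" using AB unfolding X_def by blast
      qed
    qed
    show "disjnt p q" if "p \<in> X ` \<E>" "q \<in> X ` \<E>" "p \<noteq> q" for p q
      using that meet by (auto simp: disjnt_def)
    show "{} \<notin> X ` \<E>" using ne by auto
  qed
  show "card (X E) = card E" if "E \<in> \<E>" for E
  proof -
    let ?R = "{(A, B). (A, B) \<in> f \<and> B \<subseteq> E}"
    have finD: "finite A" if "A \<in> Domain f" for A
      by (rule finite_subset[of _ "{1..n}"]) (use D(1) that in auto)
    have finR: "finite B" if "B \<in> Range f" for B
      by (rule finite_subset[of _ "{1..n}"]) (use R(1) that in auto)
    have dD: "pairwise disjnt (fst ` ?R)"
      by (rule pairwise_subset[OF D(2)]) force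
    have dR: "pairwise disjnt (snd ` ?R)"
      by (rule pairwise_subset[OF R(2)]) force
    have "X E = \<Union>(fst ` ?R)" by (force simp: X_def)
    also have "card \<dots> = sum card (fst ` ?R)"
      by (rule card_Union_disjoint[OF dD]) (auto intro: finD[OF DomainI])
    also have "\<dots> = (\<Sum>p\<in>?R. card (fst p))"
      by (subst sum.reindex) (use sv(1) in \<open>auto intro!: inj_onI dest: single_valuedD\<close>)
    also have "\<dots> = (\<Sum>p\<in>?R. card (snd p))"
      by (rule sum.cong) (use cd in auto)
    also have "\<dots> = sum card (snd ` ?R)"
      by (subst sum.reindex) (use sv(2) in \<open>auto intro!: inj_onI dest: single_valuedD\<close>)
    also have "\<dots> = card (\<Union>(snd ` ?R))"
      by (rule card_Union_disjoint[OF dR, symmetric]) (auto intro: finR[OF RangeI])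
    also have "\<Union>(snd ` ?R) = \<Union>{B | A B. (A, B) \<in> f \<and> B \<subseteq> E}" by force
    finally show ?thesis using full[OF that] by simp
  qed
qed

lemma is_ubp_raw_comp:
  assumes f: "is_ubp n f" and g: "is_ubp n g"
  shows "is_ubp n (raw_comp n g f)"
proof -
  let ?J = "partition_join n (Range f) (Domain g)"
  let ?X = "\<lambda>E. \<Union>{A | A B. (A, B) \<in> f \<and> B \<subseteq> E}"
  let ?Y = "\<lambda>E. \<Union>{D | C D. (C, D) \<in> g \<and> C \<subseteq> E}"
  have pf: "partition_on {1..n} (Range f)" and pg: "partition_on {1..n} (Domain g)"
    using f g by (auto simp: is_ubp_def)
  have rf: "refines {1..n} (Range f) ?J" by (rule partition_join(1)[OF pf pg])
  have rg: "refines {1..n} (Range (g\<inverse>)) ?J"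
    using partition_join(2)[OF pf pg] by simp
  have Y: "\<Union>{A | A B. (A, B) \<in> g\<inverse> \<and> B \<subseteq> E} = ?Y E" for E by auto
  note X = is_ubp_coarsen[OF f rf]
  note Y = is_ubp_coarsen[OF is_ubp_converse[OF g] rg, unfolded Y]
  have raw: "raw_comp n g f = (\<lambda>E. (?X E, ?Y E)) ` ?J"
    by (simp add: raw_comp_def)
  have "Domain (raw_comp n g f) = ?X ` ?J" "Range (raw_comp n g f) = ?Y ` ?J"
    unfolding raw by (auto simp: Domain_fst Range_snd image_image)
  moreover have "single_valued (raw_comp n g f)"
    unfolding raw single_valued_def by clarsimp (metis (no_types, lifting) inj_onD[OF X(2)])
  moreover have "single_valued ((raw_comp n g f)\<inverse>)"
    unfolding raw single_valued_def by clarsimp (metis (no_types, lifting) inj_onD[OF Y(2)])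
  moreover have "\<forall>(A, B)\<in>raw_comp n g f. card B = card A"
    unfolding raw using X(3) Y(3) by auto
  ultimately show ?thesis
    unfolding is_ubp_def using X(1) Y(1) by simp
qed

lemma partition_on_append:
  fixes n m :: nat
  assumes "partition_on {1..n} P" "partition_on {1..m} Q"
  shows "partition_on {1..n + m} (P \<union> (`) ((+) n) ` Q)"
proof -
  have P: "\<Union>P = {1..n}" "disjoint P" "{} \<notin> P" and Q: "\<Union>Q = {1..m}" "disjoint Q" "{} \<notin> Q"
    using assms by (auto simp: partition_on_def)
  have im: "(+) n ` {1..m} = {n + 1..n + m}"
    using image_add_atLeastAtMost[of n 1 m] by simp
  have U: "\<Union>((`) ((+) n) ` Q) = {n + 1..n + m}"
    using im Q(1) by (metis image_Union)
  have dQ: "disjoint ((`) ((+) n) ` Q)"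
    using Q(2) by (fastforce simp: disjoint_def)
  have "disjoint (P \<union> (`) ((+) n) ` Q)"
    by (rule disjoint_union) (use P dQ in \<open>auto simp: U\<close>)
  moreover have "\<Union>(P \<union> (`) ((+) n) ` Q) = {1..n + m}"
    unfolding Union_Un_distrib U P(1) by auto
  ultimately show ?thesis using P Q by (auto simp: partition_on_def)
qed

lemma is_ubp_raw_cat:
  assumes f: "is_ubp n f" and g: "is_ubp m g"
  shows "is_ubp (n + m) (raw_cat f g)"
proof -
  let ?s = "(`) ((+) n) :: nat set \<Rightarrow> nat set"
  have raw: "raw_cat f g = f \<union> (\<lambda>(A, B). (?s A, ?s B)) ` g"
    by (simp add: raw_cat_def raw_degree_eq[OF f])
  have D: "Domain (raw_cat f g) = Domain f \<union> ?s ` Domain g"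
    and R: "Range (raw_cat f g) = Range f \<union> ?s ` Range g"
    unfolding raw by (simp_all add: Domain_fst Range_snd image_Un image_image case_prod_beta)
  have pf: "partition_on {1..n} (Domain f)" "partition_on {1..n} (Range f)"
    and pg: "partition_on {1..m} (Domain g)" "partition_on {1..m} (Range g)"
    using f g by (auto simp: is_ubp_def)
  have inj: "?s A = ?s B \<longleftrightarrow> A = B" for A B :: "nat set"
    by (rule inj_image_eq_iff) simp
  have low: "A \<subseteq> {1..n} \<and> A \<noteq> {} \<and> B \<subseteq> {1..n} \<and> B \<noteq> {}" if "(A, B) \<in> f" for A B
  proof -
    have "A \<in> Domain f" "B \<in> Range f" using that by auto
    then show ?thesis using pf unfolding partition_on_def by blast
  qed
  have high: "A \<subseteq> {1..m} \<and> A \<noteq> {} \<and> B \<subseteq> {1..m} \<and> B \<noteq> {}" if "(A, B) \<in> g" for A B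
  proof -
    have "A \<in> Domain g" "B \<in> Range g" using that by auto
    then show ?thesis using pg unfolding partition_on_def by blast
  qed
  have clash: "A \<noteq> ?s C" if "A \<subseteq> {1..n}" "A \<noteq> {}" "C \<subseteq> {1..m}" for A C
    using that by fastforce
  have sv: "single_valued f" "single_valued g" "single_valued (f\<inverse>)" "single_valued (g\<inverse>)"
    using f g by (auto simp: is_ubp_def)
  have clash1: "A \<noteq> ?s C" if "(A, B) \<in> f" "(C, D) \<in> g" for A B C D
    using clash low[OF that(1)] high[OF that(2)] by blast
  have clash2: "B \<noteq> ?s D" if "(A, B) \<in> f" "(C, D) \<in> g" for A B C D
    using clash low[OF that(1)] high[OF that(2)] by blast
  have mem: "(X, Y) \<in> raw_cat f g \<longleftrightarrow>
      (X, Y) \<in> f \<or> (\<exists>A B. (A, B) \<in> g \<and> X = ?s A \<and> Y = ?s B)" for X Y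
    unfolding raw by auto
  have "single_valued (raw_cat f g)"
    unfolding single_valued_def mem
    by (metis clash1 inj single_valuedD[OF sv(1)] single_valuedD[OF sv(2)])
  moreover have "single_valued ((raw_cat f g)\<inverse>)"
    unfolding single_valued_def converse_iff mem
    by (metis clash2 converse_iff inj single_valuedD[OF sv(3)] single_valuedD[OF sv(4)])
  moreover have "\<forall>(A, B)\<in>raw_cat f g. card B = card A"
    unfolding raw using f g by (auto simp: is_ubp_def card_image)
  ultimately show ?thesis
    unfolding is_ubp_def D R using partition_on_append pf pg by blast
qed

lemma is_ubp_raw_perm:
  assumes "\<sigma> permutes {1..n}"
  shows "is_ubp n (raw_perm n \<sigma>)"
proof -
  have D: "Domain (raw_perm n \<sigma>) = (\<lambda>i. {i}) ` {1..n}"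
    by (auto simp: raw_perm_def Domain_fst image_image)
  have "Range (raw_perm n \<sigma>) = (\<lambda>i. {i}) ` (\<sigma> ` {1..n})"
    by (auto simp: raw_perm_def Range_snd image_image)
  then have R: "Range (raw_perm n \<sigma>) = (\<lambda>i. {i}) ` {1..n}"
    using permutes_image[OF assms] by simp
  have "single_valued ((raw_perm n \<sigma>)\<inverse>)"
    using permutes_inj[OF assms] by (auto simp: raw_perm_def single_valued_def dest: injD)
  moreover have "single_valued (raw_perm n \<sigma>)" "\<forall>(A, B)\<in>raw_perm n \<sigma>. card B = card A"
    by (auto simp: raw_perm_def single_valued_def)
  ultimately show ?thesis
    unfolding is_ubp_def D R by (blast intro: partition_on_singletons)
qed

typedef ubp = "{f. \<exists>n. is_ubp n f}"
  using is_ubp_empty by blast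

setup_lifting type_definition_ubp

definition ubps :: "nat \<Rightarrow> ubp set" where
  "ubps n = {f. is_ubp n (Rep_ubp f)}"

lift_definition ubp_degree :: "ubp \<Rightarrow> nat" is raw_degree .

lift_definition ubp_empty :: ubp is "{}"
  using is_ubp_empty by blast

text \<open>Only the product of two elements of the same \<open>P\<^sub>n\<close>, and \<open>ubp_perm n \<sigma>\<close> for \<open>\<sigma>\<close> a
  permutation of \<open>[n]\<close>, are meaningful; the remaining values are dummies.\<close>

lift_definition ubp_comp :: "ubp \<Rightarrow> ubp \<Rightarrow> ubp" is
  "\<lambda>g f. if raw_degree g = raw_degree f then raw_comp (raw_degree f) g f else {}"
  by (metis is_ubp_empty is_ubp_raw_comp raw_degree_eq)

lift_definition ubp_cat :: "ubp \<Rightarrow> ubp \<Rightarrow> ubp" is raw_cat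
  using is_ubp_raw_cat by blast

lift_definition ubp_perm :: "nat \<Rightarrow> (nat \<Rightarrow> nat) \<Rightarrow> ubp" is
  "\<lambda>n \<sigma>. if \<sigma> permutes {1..n} then raw_perm n \<sigma> else {}"
  using is_ubp_raw_perm is_ubp_empty by auto

definition shuffles_perm :: "nat \<Rightarrow> nat \<Rightarrow> (nat \<Rightarrow> nat) set" where
  "shuffles_perm n m =
     {\<xi>. \<xi> permutes {1..n + m} \<and> strict_mono_on {1..n} \<xi> \<and> strict_mono_on {n + 1..n + m} \<xi>}"

definition breaking_points :: "ubp \<Rightarrow> nat set" where
  "breaking_points f =
     {i \<in> {0..ubp_degree f}. \<exists>\<X> \<subseteq> Range (Rep_ubp f). \<Union>\<X> = {1..i}}"

text \<open>For a breaking point \<open>i\<close> of \<open>f \<in> P\<^sub>n\<close>, the pair of the parts of \<open>f\<close> in \<open>P\<^sub>i\<close> and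
  \<open>P\<^bsub>n-i\<^esub>\<close>.\<close>

definition ubp_split :: "ubp \<Rightarrow> nat \<Rightarrow> ubp \<times> ubp" where
  "ubp_split f i =
     (THE p. fst p \<in> ubps i \<and> snd p \<in> ubps (ubp_degree f - i) \<and>
       (\<exists>\<xi>\<in>shuffles_perm i (ubp_degree f - i).
          f = ubp_comp (ubp_cat (fst p) (snd p)) (ubp_perm (ubp_degree f) (inv \<xi>))))"


section \<open>Bialgebra structures on free modules\<close>

text \<open>The free \<open>\<k>\<close>-module on \<open>'b\<close> is \<open>'b \<Rightarrow>\<^sub>0 'k\<close>, and its tensor square is identified with the free
  module \<open>'b \<times> 'b \<Rightarrow>\<^sub>0 'k\<close>. The \<open>times\<close> instance of \<open>poly_mapping\<close> plays no role.\<close>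

definition fscale :: "'k::comm_ring_1 \<Rightarrow> ('b \<Rightarrow>\<^sub>0 'k) \<Rightarrow> ('b \<Rightarrow>\<^sub>0 'k)" where
  "fscale c x = Poly_Mapping.map ((*) c) x"

lemma lookup_fscale [simp]:
  "Poly_Mapping.lookup (fscale c x) b = c * Poly_Mapping.lookup x b"
  unfolding fscale_def by transfer (simp add: when_def)

lemma module_fscale: "module fscale"
  by standard (auto intro!: poly_mapping_eqI simp: lookup_add algebra_simps)

abbreviation basis :: "'b \<Rightarrow> ('b \<Rightarrow>\<^sub>0 'k::comm_ring_1)" where
  "basis b \<equiv> Poly_Mapping.single b 1"

definition lin_extend :: "('b \<Rightarrow> ('c \<Rightarrow>\<^sub>0 'k)) \<Rightarrow> ('b \<Rightarrow>\<^sub>0 'k) \<Rightarrow> ('c \<Rightarrow>\<^sub>0 'k::comm_ring_1)" where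
  "lin_extend \<phi> x = (\<Sum>b\<in>Poly_Mapping.keys x. fscale (Poly_Mapping.lookup x b) (\<phi> b))"

definition bilin_extend :: "('a \<Rightarrow> 'b \<Rightarrow> ('c \<Rightarrow>\<^sub>0 'k)) \<Rightarrow> ('a \<Rightarrow>\<^sub>0 'k) \<Rightarrow> ('b \<Rightarrow>\<^sub>0 'k)
    \<Rightarrow> ('c \<Rightarrow>\<^sub>0 'k::comm_ring_1)" where
  "bilin_extend \<phi> x y = lin_extend (\<lambda>a. lin_extend (\<phi> a) y) x"

definition tensor :: "('a \<Rightarrow>\<^sub>0 'k) \<Rightarrow> ('b \<Rightarrow>\<^sub>0 'k) \<Rightarrow> ('a \<times> 'b \<Rightarrow>\<^sub>0 'k::comm_ring_1)" where
  "tensor = bilin_extend (\<lambda>a b. basis (a, b))"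

text \<open>The convolution \<open>\<mu> \<circ> (F \<otimes> G) \<circ> \<Delta>\<close> of two linear endomorphisms.\<close>

definition convolution where
  "convolution mul comult F G x =
     lin_extend (\<lambda>(a, b). mul (F (basis a)) (G (basis b))) (comult x)"

definition is_antipode ::
  "(('b \<Rightarrow>\<^sub>0 'k) \<Rightarrow> ('b \<Rightarrow>\<^sub>0 'k) \<Rightarrow> ('b \<Rightarrow>\<^sub>0 'k)) \<Rightarrow> ('b \<Rightarrow>\<^sub>0 'k) \<Rightarrow>
   (('b \<Rightarrow>\<^sub>0 'k) \<Rightarrow> ('b \<times> 'b \<Rightarrow>\<^sub>0 'k)) \<Rightarrow> (('b \<Rightarrow>\<^sub>0 'k) \<Rightarrow> 'k::comm_ring_1) \<Rightarrow>
   (('b \<Rightarrow>\<^sub>0 'k) \<Rightarrow> ('b \<Rightarrow>\<^sub>0 'k)) \<Rightarrow> bool" where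
  "is_antipode mul one comult counit A \<longleftrightarrow>
     module_hom fscale fscale A \<and>
     (\<forall>x. convolution mul comult A id x = fscale (counit x) one) \<and>
     (\<forall>x. convolution mul comult id A x = fscale (counit x) one)"

definition subbialgebra ::
  "(('b \<Rightarrow>\<^sub>0 'k) \<Rightarrow> ('b \<Rightarrow>\<^sub>0 'k) \<Rightarrow> ('b \<Rightarrow>\<^sub>0 'k)) \<Rightarrow> ('b \<Rightarrow>\<^sub>0 'k) \<Rightarrow>
   (('b \<Rightarrow>\<^sub>0 'k) \<Rightarrow> ('b \<times> 'b \<Rightarrow>\<^sub>0 'k::comm_ring_1)) \<Rightarrow> ('b \<Rightarrow>\<^sub>0 'k) set \<Rightarrow> bool" where
  "subbialgebra mul one comult S \<longleftrightarrow>
     module.subspace fscale S \<and> one \<in> S \<and> (\<forall>x\<in>S. \<forall>y\<in>S. mul x y \<in> S) \<and>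
     (\<forall>x\<in>S. comult x \<in> module.span fscale {tensor y z | y z. y \<in> S \<and> z \<in> S})"

definition hopf_subalgebra ::
  "(('b \<Rightarrow>\<^sub>0 'k) \<Rightarrow> ('b \<Rightarrow>\<^sub>0 'k) \<Rightarrow> ('b \<Rightarrow>\<^sub>0 'k)) \<Rightarrow> ('b \<Rightarrow>\<^sub>0 'k) \<Rightarrow>
   (('b \<Rightarrow>\<^sub>0 'k) \<Rightarrow> ('b \<times> 'b \<Rightarrow>\<^sub>0 'k::comm_ring_1)) \<Rightarrow> (('b \<Rightarrow>\<^sub>0 'k) \<Rightarrow> ('b \<Rightarrow>\<^sub>0 'k)) \<Rightarrow>
   ('b \<Rightarrow>\<^sub>0 'k) set \<Rightarrow> bool" where
  "hopf_subalgebra mul one comult A S \<longleftrightarrow> subbialgebra mul one comult S \<and> A ` S \<subseteq> S"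


section \<open>The Hopf algebra of uniform block permutations\<close>

text \<open>The product of the direct sum of the monoid algebras \<open>\<k>P\<^sub>n\<close>.\<close>

definition monoid_algebra_mult :: "(ubp \<Rightarrow>\<^sub>0 'k) \<Rightarrow> (ubp \<Rightarrow>\<^sub>0 'k) \<Rightarrow> (ubp \<Rightarrow>\<^sub>0 'k::comm_ring_1)" where
  "monoid_algebra_mult =
     bilin_extend (\<lambda>g f. if ubp_degree g = ubp_degree f then basis (ubp_comp g f) else 0)"

definition sh :: "nat \<Rightarrow> nat \<Rightarrow> (ubp \<Rightarrow>\<^sub>0 'k::comm_ring_1)" where
  "sh n m = (\<Sum>\<xi>\<in>shuffles_perm n m. basis (ubp_perm (n + m) \<xi>))"

definition ubp_mult :: "(ubp \<Rightarrow>\<^sub>0 'k) \<Rightarrow> (ubp \<Rightarrow>\<^sub>0 'k) \<Rightarrow> (ubp \<Rightarrow>\<^sub>0 'k::comm_ring_1)" where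
  "ubp_mult =
     bilin_extend (\<lambda>f g.
       monoid_algebra_mult (sh (ubp_degree f) (ubp_degree g)) (basis (ubp_cat f g)))"

definition ubp_one :: "ubp \<Rightarrow>\<^sub>0 'k::comm_ring_1" where
  "ubp_one = basis ubp_empty"

definition ubp_comult :: "(ubp \<Rightarrow>\<^sub>0 'k) \<Rightarrow> (ubp \<times> ubp \<Rightarrow>\<^sub>0 'k::comm_ring_1)" where
  "ubp_comult =
     lin_extend (\<lambda>f. \<Sum>i\<in>breaking_points f.
       tensor (basis (fst (ubp_split f i))) (basis (snd (ubp_split f i))))"

definition ubp_counit :: "(ubp \<Rightarrow>\<^sub>0 'k) \<Rightarrow> 'k::comm_ring_1" where
  "ubp_counit x = Poly_Mapping.lookup x ubp_empty"

definition perm_ubps :: "nat \<Rightarrow> ubp set" where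
  "perm_ubps n = ubp_perm n ` {\<sigma>. \<sigma> permutes {1..n}}"

definition perm_submodule :: "(ubp \<Rightarrow>\<^sub>0 'k::comm_ring_1) set" where
  "perm_submodule = module.span fscale (\<Union>n. basis ` perm_ubps n)"

end

(* Composing with a permutation merely relabels blocks, so permutations are closed under the product.
   In a decomposition f = (f' x f'') . xi^{-1} at a breaking point i, the shuffle xi is determined by
   the set xi({1..i}), which can be read off from f; for a permutation f such a decomposition into
   permutations exists by sorting f^{-1}({1..i}) and its complement, so the coproduct preserves the
   span of the permutations. For an antipode A, the coproduct of f in degree n contains the term
   f (x) 1, so A(f) equals counit(f) 1 minus products A(f') * f'' with deg f' < n, and induction on
   n applies. *)

theory Submission
  imports Defs "HOL-Library.Infinite_Set"
begin

section \<open>Strictly increasing maps, blocks, and products with a permutation\<close>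

lemma strict_mono_on_image_unique:
  fixes f g :: "'a::wellorder \<Rightarrow> 'b::linorder"
  assumes f: "strict_mono_on A f" and g: "strict_mono_on A g" and eq: "f ` A = g ` A"
    and "x \<in> A"
  shows "f x = g x"
  using \<open>x \<in> A\<close>
proof (induction x rule: less_induct)
  case (less x)
  \<comment> \<open>If \<open>p x < q x\<close>, the value \<open>p x\<close> is attained by
    \<open>q\<close> at some \<open>z < x\<close>. There \<open>p\<close> and \<open>q\<close>
    already agree, so \<open>p z = p x\<close>, which contradicts strict monotonicity of
    \<open>p\<close>. Used in both orders, this leaves only equality.\<close>
  have no_less: "\<not> p x < q x"
    if pq: "strict_mono_on A p" "strict_mono_on A q" "p ` A = q ` A"
      and IH: "\<And>y. y < x \<Longrightarrow> y \<in> A \<Longrightarrow> p y = q y" for p q :: "'a \<Rightarrow> 'b"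
  proof
    assume lt: "p x < q x"
    have "p x \<in> q ` A" using pq(3) \<open>x \<in> A\<close> by blast
    then obtain z where z: "z \<in> A" "q z = p x" by auto
    then have "z < x"
      using lt strict_mono_onD[OF pq(2) \<open>x \<in> A\<close> z(1)] by (metis linorder_cases order.asym)
    then have "p z < p x" using strict_mono_onD[OF pq(1) z(1) \<open>x \<in> A\<close>] by blast
    then show False using IH[OF \<open>z < x\<close> z(1)] z(2) by simp
  qed
  have "\<not> f x < g x" "\<not> g x < f x"
    using no_less[OF f g eq] no_less[OF g f eq[symmetric]] less.IH by simp_all
  then show ?case by simp
qed

text \<open>Blocks are nonempty and disjoint, so inclusion forces equality. The inclusion has the
  form in which \<open>raw_comp\<close> selects blocks; it collapses the unions there to a single
  block once the join equals the range.\<close>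

lemma ubp_block_unique:
  assumes f: "is_ubp n f" and "(A, B) \<in> f" "(A', B') \<in> f" "B \<subseteq> B'"
  shows "A = A'" "B = B'"
proof -
  have R: "disjoint (Range f)" "{} \<notin> Range f" and sv: "single_valued (f\<inverse>)"
    using f by (auto simp: is_ubp_def partition_on_def)
  obtain x where "x \<in> B" using R(2) assms(2) by fastforce
  then show "B = B'" using disjoint_block_eq[OF R(1)] assms by blast
  then show "A = A'" using assms single_valuedD[OF sv] by blast
qed

lemma is_ubp_subset:
  assumes "is_ubp n f" "(A, B) \<in> f"
  shows "A \<subseteq> {1..n}" "B \<subseteq> {1..n}" "A \<noteq> {}" "B \<noteq> {}"
proof -
  have "A \<in> Domain f" "B \<in> Range f" using assms by auto
  then show "A \<subseteq> {1..n}" "B \<subseteq> {1..n}" "A \<noteq> {}" "B \<noteq> {}"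
    using assms(1) unfolding is_ubp_def partition_on_def by blast+
qed

text \<open>The partition into singletons refines every partition, so it is neutral for the join.
  This is what makes products with a permutation computable.\<close>

lemma partition_join_singletons:
  fixes n :: nat
  assumes P: "partition_on {1..n} P"
  shows "partition_join n ((\<lambda>i. {i}) ` {1..n}) P = P"
    and "partition_join n P ((\<lambda>i. {i}) ` {1..n}) = P"
proof -
  let ?S = "(\<lambda>i. {i}) ` {1..n}"
  have S: "partition_on {1..n} ?S" by (rule partition_on_singletons)
  have SP: "refines {1..n} ?S P"
    using S P by (auto simp: refines_def partition_on_def)
  note PP = refines_refl[OF P]
  show "partition_join n ?S P = P"
    using partition_join(2)[OF S P] partition_join(3)[OF S P SP PP] by (rule refines_asym[symmetric])
  show "partition_join n P ?S = P"
    using partition_join(1)[OF P S] partition_join(3)[OF P S PP SP] by (rule refines_asym[symmetric])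
qed

lemma Domain_raw_perm: "Domain (raw_perm n \<sigma>) = (\<lambda>i. {i}) ` {1..n}"
  by (auto simp: raw_perm_def Domain_fst image_image)

lemma Range_raw_perm:
  assumes "\<sigma> permutes {1..n}"
  shows "Range (raw_perm n \<sigma>) = (\<lambda>i. {i}) ` {1..n}"
proof -
  have "Range (raw_perm n \<sigma>) = (\<lambda>i. {i}) ` (\<sigma> ` {1..n})"
    by (auto simp: raw_perm_def Range_snd image_image)
  then show ?thesis using permutes_image[OF assms] by simp
qed

text \<open>The join is \<open>Range f\<close> by \<open>partition_join_singletons\<close>. A join
  block \<open>B\<close> thus collects exactly one domain block of \<open>f\<close>, and on the
  other side the images of its own points.\<close>

lemma raw_comp_perm_left:
  assumes f: "is_ubp n f"
  shows "raw_comp n (raw_perm n \<sigma>) f = (\<lambda>(A, B). (A, \<sigma> ` B)) ` f"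
proof -
  let ?c = "\<lambda>E. (\<Union>{A | A B. (A, B) \<in> f \<and> B \<subseteq> E}, \<Union>{D | C D. (C, D) \<in> raw_perm n \<sigma> \<and> C \<subseteq> E})"
  have J: "partition_join n (Range f) (Domain (raw_perm n \<sigma>)) = Range f"
    using f by (simp add: Domain_raw_perm partition_join_singletons is_ubp_def del: One_nat_def)
  have c: "?c B = (A, \<sigma> ` B)" if "(A, B) \<in> f" for A B
  proof -
    have "{A' | A' B'. (A', B') \<in> f \<and> B' \<subseteq> B} = {A}"
      using that ubp_block_unique(1)[OF f _ that] by blast
    moreover have "{D | C D. (C, D) \<in> raw_perm n \<sigma> \<and> C \<subseteq> B} = (\<lambda>i. {\<sigma> i}) ` B"
      using is_ubp_subset(2)[OF f that] unfolding raw_perm_def by blast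
    ultimately show ?thesis by (simp add: UNION_singleton_eq_range)
  qed
  have "raw_comp n (raw_perm n \<sigma>) f = ?c ` snd ` f"
    unfolding raw_comp_def J by (simp only: Range_snd)
  also have "\<dots> = (\<lambda>(A, B). (A, \<sigma> ` B)) ` f"
    unfolding image_image
  proof (rule image_cong[OF refl])
    show "?c (snd x) = (case x of (A, B) \<Rightarrow> (A, \<sigma> ` B))" if "x \<in> f" for x
      using c[of "fst x" "snd x"] that by (simp only: prod.collapse case_prod_beta)
  qed
  finally show ?thesis .
qed

text \<open>Here the join is \<open>Domain g\<close>, and the points collected on the domain side
  form the preimage of a block under \<open>\<sigma>\<close>; this is the source of
  \<open>inv \<sigma>\<close>.\<close>

lemma raw_comp_perm_right:
  assumes g: "is_ubp n g" and \<sigma>: "\<sigma> permutes {1..n}"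
  shows "raw_comp n g (raw_perm n \<sigma>) = (\<lambda>(A, B). (inv \<sigma> ` A, B)) ` g"
proof -
  let ?c = "\<lambda>E. (\<Union>{A | A B. (A, B) \<in> raw_perm n \<sigma> \<and> B \<subseteq> E}, \<Union>{D | C D. (C, D) \<in> g \<and> C \<subseteq> E})"
  have J: "partition_join n (Range (raw_perm n \<sigma>)) (Domain g) = Domain g"
    using g by (simp add: Range_raw_perm[OF \<sigma>] partition_join_singletons is_ubp_def del: One_nat_def)
  have c: "?c A = (inv \<sigma> ` A, B)" if "(A, B) \<in> g" for A B
  proof -
    have "{D | C D. (C, D) \<in> g \<and> C \<subseteq> A} = {B}"
      using that ubp_block_unique(1)[OF is_ubp_converse[OF g], of _ _ B A] by blast
    \<comment> \<open>\<open>raw_perm\<close> only ranges over [n], but so does the whole preimage: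
      \<open>A\<close> lies in [n] and \<open>\<sigma>\<close> preserves [n].\<close>
    moreover have "{X | X Y. (X, Y) \<in> raw_perm n \<sigma> \<and> Y \<subseteq> A} = (\<lambda>i. {i}) ` (\<sigma> -` A)"
    proof -
      have "i \<in> {1..n}" if "\<sigma> i \<in> A" for i
        using is_ubp_subset(1)[OF g \<open>(A, B) \<in> g\<close>] that permutes_in_image[OF \<sigma>] by blast
      then show ?thesis unfolding raw_perm_def by blast
    qed
    ultimately show ?thesis
      by (simp add: UNION_singleton_eq_range bij_vimage_eq_inv_image[OF permutes_bij[OF \<sigma>]])
  qed
  have "raw_comp n g (raw_perm n \<sigma>) = ?c ` fst ` g"
    unfolding raw_comp_def J by (simp only: Domain_fst)
  also have "\<dots> = (\<lambda>(A, B). (inv \<sigma> ` A, B)) ` g"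
    unfolding image_image
  proof (rule image_cong[OF refl])
    show "?c (fst x) = (case x of (A, B) \<Rightarrow> (inv \<sigma> ` A, B))" if "x \<in> g" for x
      using c[of "fst x" "snd x"] that by (simp only: prod.collapse case_prod_beta)
  qed
  finally show ?thesis .
qed

section \<open>Concatenation of permutations\<close>

definition perm_cat :: "nat \<Rightarrow> (nat \<Rightarrow> nat) \<Rightarrow> (nat \<Rightarrow> nat) \<Rightarrow> nat \<Rightarrow> nat" where
  "perm_cat n \<sigma> \<tau> k = (if k \<le> n then \<sigma> k else n + \<tau> (k - n))"

text \<open>As a total map, \<open>\<sigma>\<close> also fixes 0 and everything above
  \<open>n\<close>. Hence this equivalence and the bound in \<open>permutes_le_iff\<close> hold at
  every argument, in particular at truncated differences \<open>k - n\<close>.\<close>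

lemma permutes_eq_0_iff:
  fixes n :: nat
  assumes "\<sigma> permutes {1..n}"
  shows "\<sigma> k = 0 \<longleftrightarrow> k = 0"
  using permutes_in_image[OF assms, of k] permutes_not_in[OF assms, of k]
  by (cases "k \<in> {1..n}") auto

lemma permutes_le_iff:
  fixes n :: nat
  assumes "\<sigma> permutes {1..n}"
  shows "\<sigma> k \<le> n \<longleftrightarrow> k \<le> n"
  using permutes_in_image[OF assms, of k] permutes_not_in[OF assms, of k]
  by (cases "k \<in> {1..n}") auto

lemma perm_cat_permutes:
  assumes \<sigma>: "\<sigma> permutes {1..n}" and \<tau>: "\<tau> permutes {1..m}"
  shows "perm_cat n \<sigma> \<tau> permutes {1..n + m}"
proof (rule bij_imp_permutes)
  note \<sigma>_le = permutes_le_iff[OF \<sigma>] and \<sigma>0 = permutes_eq_0_iff[OF \<sigma>]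
  note \<tau>_le = permutes_le_iff[OF \<tau>] and \<tau>0 = permutes_eq_0_iff[OF \<tau>]
  have sub: "perm_cat n \<sigma> \<tau> ` {1..n + m} \<subseteq> {1..n + m}"
  proof (rule image_subsetI)
    fix k assume k: "k \<in> {1..n + m}"
    show "perm_cat n \<sigma> \<tau> k \<in> {1..n + m}"
    proof (cases "k \<le> n")
      case True
      then show ?thesis using k \<sigma>_le[of k] \<sigma>0[of k] by (auto simp: perm_cat_def)
    next
      case False
      then have "\<tau> (k - n) \<noteq> 0" "\<tau> (k - n) \<le> m" using k \<tau>0 \<tau>_le by auto
      then show ?thesis using False by (auto simp: perm_cat_def)
    qed
  qed
  have inj: "inj_on (perm_cat n \<sigma> \<tau>) {1..n + m}"
  proof (rule inj_onI)
    fix j k assume eq: "perm_cat n \<sigma> \<tau> j = perm_cat n \<sigma> \<tau> k"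
    have pos: "\<tau> (i - n) \<noteq> 0" if "\<not> i \<le> n" for i
      using that \<tau>0[of "i - n"] by simp
    \<comment> \<open>Values of the first branch are at most \<open>n\<close> and those of the
      second exceed \<open>n\<close>, so equal values come from the same branch.\<close>
    consider "j \<le> n" "k \<le> n" | "\<not> j \<le> n" "\<not> k \<le> n"
      using eq pos[of j] pos[of k] \<sigma>_le[of j] \<sigma>_le[of k]
      by (fastforce simp: perm_cat_def split: if_splits)
    then show "j = k"
    proof cases
      case 1
      then show ?thesis using eq injD[OF permutes_inj[OF \<sigma>]] by (auto simp: perm_cat_def)
    next
      case 2
      then have "j - n = k - n" using eq injD[OF permutes_inj[OF \<tau>]] by (auto simp: perm_cat_def)
      then show ?thesis using 2 by simp
    qed
  qed
  show "bij_betw (perm_cat n \<sigma> \<tau>) {1..n + m} {1..n + m}"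
    using inj endo_inj_surj[OF finite_atLeastAtMost sub inj] by (rule bij_betw_imageI)
  \<comment> \<open>The two branches of \<open>perm_cat\<close> cover the outside of [n + m] as
    well: 0 is fixed by \<open>\<sigma>\<close>, and above \<open>n + m\<close> the difference
    \<open>k - n\<close> is fixed by \<open>\<tau>\<close>.\<close>
  show "perm_cat n \<sigma> \<tau> k = k" if k: "k \<notin> {1..n + m}" for k
  proof (cases "k \<le> n")
    case True
    then have "k = 0" using k by auto
    then show ?thesis using \<sigma>0[of 0] by (simp add: perm_cat_def)
  next
    case False
    then have "k - n \<notin> {1..m}" using k by auto
    then show ?thesis using False permutes_not_in[OF \<tau>, of "k - n"] by (simp add: perm_cat_def)
  qed
qed

lemma raw_cat_raw_perm:
  assumes \<sigma>: "\<sigma> permutes {1..n}"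
  shows "raw_cat (raw_perm n \<sigma>) (raw_perm m \<tau>) = raw_perm (n + m) (perm_cat n \<sigma> \<tau>)"
proof -
  have split: "{1..n + m} = {1..n} \<union> (+) n ` {1..m}"
    using image_add_atLeastAtMost[of n 1 m] by auto
  have "raw_perm (n + m) (perm_cat n \<sigma> \<tau>) =
      (\<lambda>i. ({i}, {\<sigma> i})) ` {1..n} \<union> (\<lambda>i. ({n + i}, {n + \<tau> i})) ` {1..m}"
    unfolding raw_perm_def split image_Un image_image
    by (intro arg_cong2[of _ _ _ _ "(\<union>)"] image_cong refl) (auto simp: perm_cat_def)
  also have "\<dots> = raw_cat (raw_perm n \<sigma>) (raw_perm m \<tau>)"
    unfolding raw_cat_def raw_degree_eq[OF is_ubp_raw_perm[OF \<sigma>]]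
    by (simp add: raw_perm_def image_image)
  finally show ?thesis ..
qed

section \<open>Products and concatenations of permutations in the type of uniform block
  permutations\<close>

lemma Rep_ubp_perm [simp]: "\<sigma> permutes {1..n} \<Longrightarrow> Rep_ubp (ubp_perm n \<sigma>) = raw_perm n \<sigma>"
  by (simp add: ubp_perm.rep_eq)

lemma ubp_perm_in_ubps: "\<sigma> permutes {1..n} \<Longrightarrow> ubp_perm n \<sigma> \<in> ubps n"
  by (simp add: ubps_def is_ubp_raw_perm)

lemma ubp_degree_ubps: "f \<in> ubps n \<Longrightarrow> ubp_degree f = n"
  by (simp add: ubps_def ubp_degree.rep_eq raw_degree_eq)

lemma ubp_cat_in_ubps: "f \<in> ubps n \<Longrightarrow> g \<in> ubps m \<Longrightarrow> ubp_cat f g \<in> ubps (n + m)"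
  by (simp add: ubps_def ubp_cat.rep_eq is_ubp_raw_cat)

lemma ubp_empty_in_ubps: "ubp_empty \<in> ubps 0"
  by (simp add: ubps_def ubp_empty.rep_eq is_ubp_empty)

lemma ubps_degree: "f \<in> ubps (ubp_degree f)"
  using Rep_ubp[of f] ubp_degree_ubps[of f] by (auto simp: ubps_def)

lemma Rep_ubp_comp:
  assumes "f \<in> ubps n" "g \<in> ubps n"
  shows "Rep_ubp (ubp_comp g f) = raw_comp n (Rep_ubp g) (Rep_ubp f)"
  using assms by (simp add: ubp_comp.rep_eq raw_degree_eq ubps_def)

lemma ubp_comp_perm:
  assumes \<sigma>: "\<sigma> permutes {1..n}" and \<tau>: "\<tau> permutes {1..n}"
  shows "ubp_comp (ubp_perm n \<sigma>) (ubp_perm n \<tau>) = ubp_perm n (\<sigma> \<circ> \<tau>)"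
proof -
  have "Rep_ubp (ubp_comp (ubp_perm n \<sigma>) (ubp_perm n \<tau>)) = raw_comp n (raw_perm n \<sigma>) (raw_perm n \<tau>)"
    using Rep_ubp_comp[OF ubp_perm_in_ubps[OF \<tau>] ubp_perm_in_ubps[OF \<sigma>]] \<sigma> \<tau> by simp
  also have "\<dots> = raw_perm n (\<sigma> \<circ> \<tau>)"
    unfolding raw_comp_perm_left[OF is_ubp_raw_perm[OF \<tau>]] by (simp add: raw_perm_def image_image)
  finally show ?thesis
    using permutes_compose[OF \<tau> \<sigma>] by (simp flip: Rep_ubp_inject)
qed

lemma ubp_cat_perm:
  assumes "\<sigma> permutes {1..n}" "\<tau> permutes {1..m}"
  shows "ubp_cat (ubp_perm n \<sigma>) (ubp_perm m \<tau>) = ubp_perm (n + m) (perm_cat n \<sigma> \<tau>)"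
  using assms by (simp add: Rep_ubp_inject[symmetric] ubp_cat.rep_eq raw_cat_raw_perm perm_cat_permutes
      del: One_nat_def)

lemma ubp_perm_0: "ubp_perm 0 id = ubp_empty"
  by (simp add: Rep_ubp_inject[symmetric] ubp_empty.rep_eq raw_perm_def permutes_id)

lemma ubp_cat_empty: "ubp_cat f ubp_empty = f"
  by (simp add: Rep_ubp_inject[symmetric] ubp_cat.rep_eq ubp_empty.rep_eq raw_cat_def)

lemma ubp_comp_id:
  assumes "f \<in> ubps n"
  shows "ubp_comp (ubp_perm n id) f = f"
  using assms Rep_ubp_comp[OF assms ubp_perm_in_ubps[OF permutes_id]]
  by (simp add: Rep_ubp_inject[symmetric] permutes_id ubps_def raw_comp_perm_left)

section \<open>Shuffles and decompositions at a breaking point\<close>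

lemma shuffles_perm_permutes: "\<xi> \<in> shuffles_perm n m \<Longrightarrow> \<xi> permutes {1..n + m}"
  by (simp add: shuffles_perm_def)

text \<open>The images of the two intervals are complementary, so the first determines the second;
  on each interval a strictly increasing map is determined by its image.\<close>

lemma shuffles_perm_image_unique:
  assumes \<xi>: "\<xi> \<in> shuffles_perm n m" and \<zeta>: "\<zeta> \<in> shuffles_perm n m"
    and eq: "\<xi> ` {1..n} = \<zeta> ` {1..n}"
  shows "\<xi> = \<zeta>"
proof
  fix x
  have p: "\<xi> permutes {1..n + m}" "\<zeta> permutes {1..n + m}"
    and mono: "strict_mono_on {1..n} \<xi>" "strict_mono_on {n + 1..n + m} \<xi>"
      "strict_mono_on {1..n} \<zeta>" "strict_mono_on {n + 1..n + m} \<zeta>"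
    using \<xi> \<zeta> by (auto simp: shuffles_perm_def)
  have "{n + 1..n + m} = {1..n + m} - {1..n}" by auto
  then have compl: "\<alpha> ` {n + 1..n + m} = {1..n + m} - \<alpha> ` {1..n}" if "\<alpha> permutes {1..n + m}" for \<alpha>
    using image_set_diff[OF permutes_inj[OF that]] permutes_image[OF that] by simp
  consider "x \<in> {1..n}" | "x \<in> {n + 1..n + m}" | "x \<notin> {1..n + m}" by force
  then show "\<xi> x = \<zeta> x"
  proof cases
    case 1
    then show ?thesis using strict_mono_on_image_unique[OF mono(1,3) eq] by simp
  next
    case 2
    then show ?thesis
      by (intro strict_mono_on_image_unique[OF mono(2,4)]) (simp only: compl[OF p(1)] compl[OF p(2)] eq)
  next
    case 3
    then show ?thesis using p[THEN permutes_not_in, OF 3] by simp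
  qed
qed

lemma shuffles_perm_exists:
  assumes S: "S \<subseteq> {1..n + m}" "card S = n"
  obtains \<xi> where "\<xi> \<in> shuffles_perm n m" "\<xi> ` {1..n} = S"
proof -
  have fin: "finite S" using S(1) finite_subset by blast
  let ?T = "{1..n + m} - S"
  have T: "card ?T = m" using S fin by (simp add: card_Diff_subset)
  obtain g where g: "bij_betw g {..<n} S" "strict_mono_on {..<n} g"
    using ex_bij_betw_strict_mono_card[OF fin] S(2) by metis
  obtain h where h: "bij_betw h {..<m} ?T" "strict_mono_on {..<m} h"
    using ex_bij_betw_strict_mono_card[of ?T] T by auto
  \<comment> \<open>The shuffle lists \<open>S\<close> and then its complement, both increasingly.
    The enumerations \<open>g\<close> and \<open>h\<close> start at index 0 and positions start at
    1, hence the shifts by \<open>1\<close> and \<open>n + 1\<close>; elsewhere \<open>\<xi>\<close>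
    is the identity, as \<open>permutes\<close> demands.\<close>
  define \<xi> where "\<xi> k = (if k \<in> {1..n} then g (k - 1)
     else if k \<in> {n + 1..n + m} then h (k - n - 1) else k)" for k
  have b1: "bij_betw (\<lambda>k. k - 1) {1..n} {..<n}"
    by (rule bij_betw_byWitness[of _ Suc]) auto
  have b2: "bij_betw (\<lambda>k. k - n - 1) {n + 1..n + m} {..<m}"
    by (rule bij_betw_byWitness[of _ "\<lambda>k. n + k + 1"]) auto
  have B1: "bij_betw \<xi> {1..n} S"
    using bij_betw_trans[OF b1 g(1)] by (subst bij_betw_cong[of _ _ "g \<circ> (\<lambda>k. k - 1)"]) (auto simp: \<xi>_def)
  have B2: "bij_betw \<xi> {n + 1..n + m} ?T"
    using bij_betw_trans[OF b2 h(1)]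
    by (subst bij_betw_cong[of _ _ "h \<circ> (\<lambda>k. k - n - 1)"]) (auto simp: \<xi>_def)
  have "{1..n} \<union> {n + 1..n + m} = {1..n + m}" "S \<union> ?T = {1..n + m}" using S(1) by auto
  then have "bij_betw \<xi> {1..n + m} {1..n + m}"
    using bij_betw_combine[OF B1 B2] by auto
  then have "\<xi> permutes {1..n + m}"
    by (rule bij_imp_permutes) (auto simp: \<xi>_def)
  moreover have "strict_mono_on {1..n} \<xi>"
    by (rule strict_mono_onI) (auto simp: \<xi>_def intro!: strict_mono_onD[OF g(2)])
  moreover have "strict_mono_on {n + 1..n + m} \<xi>"
    by (rule strict_mono_onI) (auto simp: \<xi>_def intro!: strict_mono_onD[OF h(2)])
  ultimately have "\<xi> \<in> shuffles_perm n m" by (simp add: shuffles_perm_def)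
  moreover have "\<xi> ` {1..n} = S" using B1 by (simp add: bij_betw_def)
  ultimately show thesis by (rule that)
qed

lemma shuffles_perm_0: "shuffles_perm n 0 = {id}"
proof -
  have id: "id \<in> shuffles_perm n 0"
    by (simp add: shuffles_perm_def permutes_id monotone_on_def)
  moreover have "\<xi> = id" if "\<xi> \<in> shuffles_perm n 0" for \<xi>
    using shuffles_perm_image_unique[OF that id] permutes_image[OF shuffles_perm_permutes[OF that]]
    by simp
  ultimately show ?thesis by blast
qed


text \<open>Right multiplication by the inverse of \<open>\<xi>\<close> relabels the domain blocks
  by \<open>\<xi>\<close> and keeps the codomain blocks. The codomain blocks inside [i] are
  therefore those of \<open>p\<close>, and the others are the shifted ones of \<open>q\<close>. So
  \<open>f\<close> alone determines the image of [i] under \<open>\<xi>\<close>, and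
  \<open>f\<close> and \<open>\<xi>\<close> together determine \<open>p\<close> and
  \<open>q\<close>.\<close>

lemma raw_shuffle_decomposition:
  assumes p: "is_ubp i p" and q: "is_ubp m q" and \<xi>: "\<xi> permutes {1..i + m}"
    and f: "f = raw_comp (i + m) (raw_cat p q) (raw_perm (i + m) (inv \<xi>))"
  shows "\<xi> ` {1..i} = \<Union>{A | A B. (A, B) \<in> f \<and> B \<subseteq> {1..i}}"
    and "p = {(A, B). (\<xi> ` A, B) \<in> f \<and> B \<subseteq> {1..i}}"
    and "q = {(A, B). (\<xi> ` (+) i ` A, (+) i ` B) \<in> f \<and> B \<subseteq> {1..m}}"
proof -
  have inj: "\<xi> ` A = \<xi> ` B \<longleftrightarrow> A = B" for A B
    by (rule inj_image_eq_iff[OF permutes_inj[OF \<xi>]])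
  have shift: "(+) i ` A = (+) i ` B \<longleftrightarrow> A = B" for A B :: "nat set"
    by (rule inj_image_eq_iff) simp
  have feq: "f = (\<lambda>(A, B). (\<xi> ` A, B)) ` raw_cat p q"
    unfolding f raw_comp_perm_right[OF is_ubp_raw_cat[OF p q] permutes_inv[OF \<xi>]]
    by (simp add: permutes_inv_inv[OF \<xi>])
  have mem: "(\<xi> ` A, B) \<in> f \<longleftrightarrow>
      (A, B) \<in> p \<or> (\<exists>C D. (C, D) \<in> q \<and> A = (+) i ` C \<and> B = (+) i ` D)" for A B
  proof -
    have "(\<xi> ` A, B) \<in> f \<longleftrightarrow> (A, B) \<in> raw_cat p q"
      unfolding feq by (auto simp: inj)
    then show ?thesis
      by (simp add: raw_cat_def raw_degree_eq[OF p] image_iff Bex_def)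
  qed
  have mem_ex: "\<exists>A. X = \<xi> ` A" if "(X, B) \<in> f" for X B
    using that unfolding feq by auto
  have low: "B \<subseteq> {1..i}" if "(A, B) \<in> p" for A B
    by (rule is_ubp_subset[OF p that])
  have high: "\<not> (+) i ` B \<subseteq> {1..i}" if "(A, B) \<in> q" for A B
    using is_ubp_subset[OF q that] by fastforce
  have "{A | A B. (A, B) \<in> f \<and> B \<subseteq> {1..i}} = (`) \<xi> ` Domain p"
  proof (intro set_eqI iffI)
    fix X assume "X \<in> {A | A B. (A, B) \<in> f \<and> B \<subseteq> {1..i}}"
    then obtain B where B: "(X, B) \<in> f" "B \<subseteq> {1..i}" by blast
    then obtain A where "X = \<xi> ` A" using mem_ex by blast
    with B have "(A, B) \<in> p" using mem[of A B] high by auto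
    then show "X \<in> (`) \<xi> ` Domain p" using \<open>X = \<xi> ` A\<close> by blast
  next
    fix X assume "X \<in> (`) \<xi> ` Domain p"
    then obtain A B where "(A, B) \<in> p" "X = \<xi> ` A" by blast
    then have "(X, B) \<in> f" "B \<subseteq> {1..i}" using mem[of A B] low by simp_all
    then show "X \<in> {A | A B. (A, B) \<in> f \<and> B \<subseteq> {1..i}}" by blast
  qed
  moreover have "\<Union>(Domain p) = {1..i}" using p by (auto simp: is_ubp_def partition_on_def)
  ultimately show "\<xi> ` {1..i} = \<Union>{A | A B. (A, B) \<in> f \<and> B \<subseteq> {1..i}}"
    by (metis image_Union)
  show "p = {(A, B). (\<xi> ` A, B) \<in> f \<and> B \<subseteq> {1..i}}"
    unfolding mem using low high by blast
  \<comment> \<open>Codomain blocks of \<open>p\<close> are nonempty subsets of [i], whereas a shift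
    by \<open>i\<close> of positive numbers lies above \<open>i\<close>.\<close>
  have "(C, D) \<notin> p" if "D = (+) i ` B" "B \<subseteq> {1..m}" for B C D
    using is_ubp_subset[OF p, of C D] that by fastforce
  moreover have "B \<subseteq> {1..m}" if "(A, B) \<in> q" for A B
    by (rule is_ubp_subset[OF q that])
  ultimately show "q = {(A, B). (\<xi> ` (+) i ` A, (+) i ` B) \<in> f \<and> B \<subseteq> {1..m}}"
    unfolding mem shift by blast
qed

text \<open>Both shuffles send [i] to the same set, read off from the common product, so they
  coincide; the two factors are then recovered by the same formulas. This justifies the definite
  description in \<open>ubp_split\<close>.\<close>

lemma shuffle_decomposition_unique:
  assumes p: "p \<in> ubps i" "p' \<in> ubps i" and q: "q \<in> ubps m" "q' \<in> ubps m"
    and \<xi>: "\<xi> \<in> shuffles_perm i m" "\<xi>' \<in> shuffles_perm i m"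
    and eq: "ubp_comp (ubp_cat p q) (ubp_perm (i + m) (inv \<xi>)) =
      ubp_comp (ubp_cat p' q') (ubp_perm (i + m) (inv \<xi>'))"
  shows "p = p'" "q = q'"
proof -
  let ?f = "Rep_ubp (ubp_comp (ubp_cat p q) (ubp_perm (i + m) (inv \<xi>)))"
  have raw: "Rep_ubp (ubp_comp (ubp_cat r s) (ubp_perm (i + m) (inv \<zeta>))) =
      raw_comp (i + m) (raw_cat (Rep_ubp r) (Rep_ubp s)) (raw_perm (i + m) (inv \<zeta>))"
    if "r \<in> ubps i" "s \<in> ubps m" "\<zeta> permutes {1..i + m}" for r s \<zeta>
    using Rep_ubp_comp[OF ubp_perm_in_ubps ubp_cat_in_ubps, OF permutes_inv] that permutes_inv[OF that(3)]
    by (simp add: ubp_cat.rep_eq del: One_nat_def)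
  note perm = \<xi>[THEN shuffles_perm_permutes]
  have ubp: "is_ubp i (Rep_ubp p)" "is_ubp i (Rep_ubp p')" "is_ubp m (Rep_ubp q)" "is_ubp m (Rep_ubp q')"
    using p q by (simp_all add: ubps_def)
  note d = raw_shuffle_decomposition[OF ubp(1,3) perm(1) raw[OF p(1) q(1) perm(1)]]
  note d' = raw_shuffle_decomposition[OF ubp(2,4) perm(2) raw[OF p(2) q(2) perm(2)], folded eq]
  have "\<xi> = \<xi>'" using shuffles_perm_image_unique[OF \<xi>] d(1) d'(1) by simp
  then show "p = p'" "q = q'"
    using d(2,3) d'(2,3) by (simp_all flip: Rep_ubp_inject del: One_nat_def)
qed

text \<open>For evaluating \<open>ubp_split\<close> it suffices to exhibit one decomposition, since
  \<open>shuffle_decomposition_unique\<close> excludes any other.\<close>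

lemma ubp_split_eqI:
  assumes p: "p \<in> ubps i" and q: "q \<in> ubps m" and \<xi>: "\<xi> \<in> shuffles_perm i m"
    and f: "f = ubp_comp (ubp_cat p q) (ubp_perm (i + m) (inv \<xi>))" and deg: "ubp_degree f = i + m"
  shows "ubp_split f i = (p, q)"
  unfolding ubp_split_def deg add_diff_cancel_left'
proof (rule the_equality)
  show "fst (p, q) \<in> ubps i \<and> snd (p, q) \<in> ubps m \<and>
    (\<exists>\<xi>\<in>shuffles_perm i m.
        f = ubp_comp (ubp_cat (fst (p, q)) (snd (p, q))) (ubp_perm (i + m) (inv \<xi>)))"
    using p q \<xi> f by auto
next
  fix r
  assume r: "fst r \<in> ubps i \<and> snd r \<in> ubps m \<and>
    (\<exists>\<xi>\<in>shuffles_perm i m.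
        f = ubp_comp (ubp_cat (fst r) (snd r)) (ubp_perm (i + m) (inv \<xi>)))"
  then obtain \<zeta> where "\<zeta> \<in> shuffles_perm i m"
    "f = ubp_comp (ubp_cat (fst r) (snd r)) (ubp_perm (i + m) (inv \<zeta>))" by blast
  then show "r = (p, q)"
    using shuffle_decomposition_unique[of "fst r" i p "snd r" m q \<zeta> \<xi>] r p q \<xi> f
    by (auto simp: prod_eq_iff)
qed

section \<open>Splitting permutations, and the last term of the coproduct\<close>

lemma perm_cat_cases:
  assumes \<rho>: "\<rho> permutes {1..n + m}" and im: "\<rho> ` {1..n} = {1..n}"
  obtains \<sigma> \<tau> where "\<sigma> permutes {1..n}" "\<tau> permutes {1..m}" "perm_cat n \<sigma> \<tau> = \<rho>"
proof -
  \<comment> \<open>Both factors are restrictions of \<open>\<rho>\<close> to one of the two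
    invariant intervals, the second conjugated by the shift by \<open>n\<close>, extended by the
    identity.\<close>
  define \<sigma> where "\<sigma> k = (if k \<in> {1..n} then \<rho> k else k)" for k
  define \<tau> where "\<tau> k = (if k \<in> {1..m} then \<rho> (n + k) - n else k)" for k
  have inj: "inj_on \<rho> A" for A using inj_on_subset[OF permutes_inj[OF \<rho>] subset_UNIV] .
  have bij: "bij_betw \<rho> {1..n} {1..n}" using im inj by (simp add: bij_betw_def)
  have "{n + 1..n + m} = {1..n + m} - {1..n}" by auto
  then have "\<rho> ` {n + 1..n + m} = {n + 1..n + m}"
    using image_set_diff[OF permutes_inj[OF \<rho>]] permutes_image[OF \<rho>] im by simp
  then have high: "bij_betw \<rho> {n + 1..n + m} {n + 1..n + m}" using inj by (simp add: bij_betw_def)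
  have "\<sigma> permutes {1..n}"
    by (rule bij_imp_permutes[OF bij_betw_cong[THEN iffD1, OF _ bij]]) (auto simp: \<sigma>_def)
  moreover have "\<tau> permutes {1..m}"
  proof (rule bij_imp_permutes)
    have up: "bij_betw ((+) n) {1..m} {n + 1..n + m}"
      by (rule bij_betw_byWitness[of _ "\<lambda>k. k - n"]) auto
    have down: "bij_betw (\<lambda>k. k - n) {n + 1..n + m} {1..m}"
      by (rule bij_betw_byWitness[of _ "(+) n"]) auto
    show "bij_betw \<tau> {1..m} {1..m}"
      by (rule bij_betw_cong[THEN iffD1, OF _ bij_betw_trans[OF bij_betw_trans[OF up high] down]])
        (auto simp: \<tau>_def)
  qed (auto simp: \<tau>_def)
  moreover have "perm_cat n \<sigma> \<tau> = \<rho>"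
  proof
    fix k
    consider "k \<in> {1..n}" | "k \<in> {n + 1..n + m}" | "k = 0" | "k > n + m" by force
    then show "perm_cat n \<sigma> \<tau> k = \<rho> k"
    proof cases
      case 2
      \<comment> \<open>Since \<open>\<rho> k\<close> exceeds \<open>n\<close>, the subtraction in
        \<open>\<tau>\<close> is not truncated and adding \<open>n\<close> restores the
        value.\<close>
      then have "\<rho> k \<in> {n + 1..n + m}" using high by (auto simp: bij_betw_def)
      then show ?thesis using 2 by (auto simp: perm_cat_def \<tau>_def)
    qed (use permutes_not_in[OF \<rho>, of k] in \<open>auto simp: perm_cat_def \<sigma>_def \<tau>_def\<close>)
  qed
  ultimately show thesis by (rule that)
qed

text \<open>A shuffle \<open>\<xi>\<close> with the same image of [i] as \<open>inv \<sigma>\<close>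
  makes \<open>\<sigma> \<circ> \<xi>\<close> preserve [i]. That composite is thus a concatenation,
  and composing it with the inverse of \<open>\<xi>\<close> returns \<open>\<sigma>\<close>. For a
  permutation every \<open>i\<close> up to the degree is a breaking point.\<close>

lemma ubp_split_perm:
  assumes \<sigma>: "\<sigma> permutes {1..i + m}"
  shows "fst (ubp_split (ubp_perm (i + m) \<sigma>) i) \<in> perm_ubps i"
    and "snd (ubp_split (ubp_perm (i + m) \<sigma>) i) \<in> perm_ubps m"
proof -
  have "inv \<sigma> ` {1..i} \<subseteq> {1..i + m}"
    using image_mono[of "{1..i}" "{1..i + m}" "inv \<sigma>"] permutes_image[OF permutes_inv[OF \<sigma>]]
    by simp
  moreover have "card (inv \<sigma> ` {1..i}) = i"
    using card_image[OF inj_on_subset[OF permutes_inj[OF permutes_inv[OF \<sigma>]] subset_UNIV]] by simp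
  ultimately obtain \<xi> where \<xi>: "\<xi> \<in> shuffles_perm i m" "\<xi> ` {1..i} = inv \<sigma> ` {1..i}"
    by (rule shuffles_perm_exists)
  note \<xi>_perm = shuffles_perm_permutes[OF \<xi>(1)]
  have "(\<sigma> \<circ> \<xi>) ` {1..i} = {1..i}"
    unfolding image_comp[symmetric] \<xi>(2)
    by (simp add: image_comp permutes_inv_o(1)[OF \<sigma>] del: One_nat_def)
  with permutes_compose[OF \<xi>_perm \<sigma>] obtain \<alpha> \<beta>
    where ab: "\<alpha> permutes {1..i}" "\<beta> permutes {1..m}" and cat: "perm_cat i \<alpha> \<beta> = \<sigma> \<circ> \<xi>"
    by (rule perm_cat_cases)
  have "ubp_comp (ubp_cat (ubp_perm i \<alpha>) (ubp_perm m \<beta>)) (ubp_perm (i + m) (inv \<xi>)) =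
      ubp_perm (i + m) (\<sigma> \<circ> \<xi> \<circ> inv \<xi>)"
    unfolding ubp_cat_perm[OF ab] cat
    by (rule ubp_comp_perm[OF permutes_compose[OF \<xi>_perm \<sigma>] permutes_inv[OF \<xi>_perm]])
  also have "\<sigma> \<circ> \<xi> \<circ> inv \<xi> = \<sigma>" by (simp add: comp_assoc permutes_inv_o(1)[OF \<xi>_perm])
  finally have "ubp_split (ubp_perm (i + m) \<sigma>) i = (ubp_perm i \<alpha>, ubp_perm m \<beta>)"
    by (rule ubp_split_eqI[OF ubp_perm_in_ubps[OF ab(1)] ubp_perm_in_ubps[OF ab(2)] \<xi>(1) sym
          ubp_degree_ubps[OF ubp_perm_in_ubps[OF \<sigma>]]])
  then show "fst (ubp_split (ubp_perm (i + m) \<sigma>) i) \<in> perm_ubps i"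
    "snd (ubp_split (ubp_perm (i + m) \<sigma>) i) \<in> perm_ubps m"
    using ab by (auto simp: perm_ubps_def)
qed

text \<open>The identity serves as the shuffle. This supplies the term of the coproduct that
  isolates the value of an antipode at \<open>f\<close>.\<close>

lemma ubp_split_degree:
  assumes "f \<in> ubps n"
  shows "ubp_split f n = (f, ubp_empty)"
proof (rule ubp_split_eqI[where \<xi> = id and m = 0])
  show "f = ubp_comp (ubp_cat f ubp_empty) (ubp_perm (n + 0) (inv id))"
    using assms Rep_ubp_comp[OF ubp_perm_in_ubps[OF permutes_id] assms]
    by (simp add: Rep_ubp_inject[symmetric] ubp_cat_empty ubps_def permutes_id raw_comp_perm_right
        del: One_nat_def)
qed (use assms in \<open>simp_all add: ubp_empty_in_ubps shuffles_perm_0 ubp_degree_ubps\<close>)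

lemma degree_in_breaking_points:
  assumes "f \<in> ubps n"
  shows "n \<in> breaking_points f"
proof -
  have "\<Union>(Range (Rep_ubp f)) = {1..n}"
    using assms by (auto simp: ubps_def is_ubp_def partition_on_def)
  then show ?thesis using ubp_degree_ubps[OF assms] by (auto simp: breaking_points_def)
qed

lemma finite_breaking_points [simp]: "finite (breaking_points f)"
  by (simp add: breaking_points_def)

section \<open>Linear extension and spans of basis vectors\<close>

interpretation fscale: module fscale
  by (rule module_fscale)

text \<open>Cancellation can make the support of a sum smaller than the union of the supports;
  expanding over a common finite set allows termwise comparison.\<close>

lemma lin_extend_superset:
  assumes "finite K" "Poly_Mapping.keys x \<subseteq> K"
  shows "lin_extend \<phi> x = (\<Sum>b\<in>K. fscale (Poly_Mapping.lookup x b) (\<phi> b))"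
  unfolding lin_extend_def
  by (rule sum.mono_neutral_left) (use assms in \<open>auto simp: in_keys_iff\<close>)

lemma lin_extend_add: "lin_extend \<phi> (x + y) = lin_extend \<phi> x + lin_extend \<phi> y"
proof -
  let ?K = "Poly_Mapping.keys x \<union> Poly_Mapping.keys y"
  have "lin_extend \<phi> z = (\<Sum>b\<in>?K. fscale (Poly_Mapping.lookup z b) (\<phi> b))"
    if "Poly_Mapping.keys z \<subseteq> ?K" for z
    using that by (intro lin_extend_superset) auto
  then show ?thesis
    using Poly_Mapping.keys_add[of x y]
    by (simp add: lookup_add fscale.scale_left_distrib sum.distrib)
qed

lemma lin_extend_basis [simp]: "lin_extend \<phi> (basis b) = \<phi> b"
  by (simp add: lin_extend_def)

lemma lin_extend_sum: "lin_extend \<phi> (\<Sum>i\<in>I. x i) = (\<Sum>i\<in>I. lin_extend \<phi> (x i))"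
  \<comment> \<open>For an infinite index set both sums are 0 by convention.\<close>
  by (induction I rule: infinite_finite_induct) (simp_all add: lin_extend_add lin_extend_def[of _ 0])

lemma lin_extend_basis_id: "lin_extend basis x = x"
proof (rule poly_mapping_eqI)
  fix k
  have "Poly_Mapping.lookup (lin_extend basis x) k =
      (\<Sum>b\<in>Poly_Mapping.keys x. if k = b then Poly_Mapping.lookup x b else 0)"
    unfolding lin_extend_def lookup_sum
    by (rule sum.cong) (auto simp: lookup_single when_def)
  also have "\<dots> = Poly_Mapping.lookup x k"
    by (auto simp: in_keys_iff)
  finally show "Poly_Mapping.lookup (lin_extend basis x) k = Poly_Mapping.lookup x k" .
qed

lemma lin_extend_in_subspace:
  assumes "fscale.subspace T" "\<And>b. b \<in> Poly_Mapping.keys x \<Longrightarrow> \<phi> b \<in> T"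
  shows "lin_extend \<phi> x \<in> T"
  unfolding lin_extend_def
  using assms by (intro fscale.subspace_sum fscale.subspace_scale)

lemma bilin_extend_in_subspace:
  assumes "fscale.subspace T"
    and "\<And>a b. a \<in> Poly_Mapping.keys x \<Longrightarrow> b \<in> Poly_Mapping.keys y \<Longrightarrow> \<phi> a b \<in> T"
  shows "bilin_extend \<phi> x y \<in> T"
  unfolding bilin_extend_def using assms by (intro lin_extend_in_subspace)

lemma bilin_extend_basis [simp]: "bilin_extend \<phi> (basis a) (basis b) = \<phi> a b"
  by (simp add: bilin_extend_def)

lemma tensor_basis: "tensor (basis a) (basis b) = basis (a, b)"
  by (simp add: tensor_def)

text \<open>Passing from the span to supports reduces closure under product and coproduct to basis
  elements.\<close>

lemma keys_span_basis:
  assumes "x \<in> fscale.span (basis ` B)"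
  shows "Poly_Mapping.keys x \<subseteq> B"
  using assms
proof (induction rule: fscale.span_induct_alt)
  case base
  then show ?case by simp
next
  case (step c x y)
  then obtain b where b: "b \<in> B" "x = basis b" by blast
  have "Poly_Mapping.keys (fscale c x) \<subseteq> {b}"
    by (auto simp: in_keys_iff b(2) lookup_single when_def split: if_splits)
  then show ?case using Poly_Mapping.keys_add[of "fscale c x" y] step.IH b(1) by blast
qed

section \<open>The span of the permutations is a subbialgebra\<close>

lemma subspace_perm_submodule: "fscale.subspace perm_submodule"
  by (simp add: perm_submodule_def fscale.subspace_span)

lemma basis_in_perm_submodule:
  assumes "f \<in> perm_ubps n"
  shows "basis f \<in> perm_submodule"
  unfolding perm_submodule_def using assms by (intro fscale.span_base) blast

lemma keys_perm_submodule:
  assumes "x \<in> perm_submodule" "f \<in> Poly_Mapping.keys x"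
  obtains n \<sigma> where "\<sigma> permutes {1..n}" "f = ubp_perm n \<sigma>"
proof -
  have "x \<in> fscale.span (basis ` (\<Union>n. perm_ubps n))"
    using assms(1) by (simp add: perm_submodule_def image_UN)
  then show thesis using keys_span_basis assms(2) that by (fastforce simp: perm_ubps_def)
qed

text \<open>On basis elements the product is a sum over shuffles, and each summand is a shuffle
  composed with a concatenation of permutations, so again a permutation.\<close>

lemma ubp_mult_perm_submodule:
  assumes x: "x \<in> perm_submodule" and y: "y \<in> perm_submodule"
  shows "ubp_mult x y \<in> perm_submodule"
  unfolding ubp_mult_def
proof (rule bilin_extend_in_subspace[OF subspace_perm_submodule])
  fix f g assume f: "f \<in> Poly_Mapping.keys x" and g: "g \<in> Poly_Mapping.keys y"
  obtain n \<sigma> where \<sigma>: "\<sigma> permutes {1..n}" and f_eq: "f = ubp_perm n \<sigma>"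
    using keys_perm_submodule[OF x f] .
  obtain m \<tau> where \<tau>: "\<tau> permutes {1..m}" and g_eq: "g = ubp_perm m \<tau>"
    using keys_perm_submodule[OF y g] .
  note cat_perm = perm_cat_permutes[OF \<sigma> \<tau>]
  have deg: "ubp_degree (ubp_perm k \<alpha>) = k" if "\<alpha> permutes {1..k}" for k \<alpha>
    by (rule ubp_degree_ubps[OF ubp_perm_in_ubps[OF that]])
  have "monoid_algebra_mult (sh n m) (basis (ubp_perm (n + m) (perm_cat n \<sigma> \<tau>))) =
      (\<Sum>\<xi>\<in>shuffles_perm n m. basis (ubp_perm (n + m) (\<xi> \<circ> perm_cat n \<sigma> \<tau>)))"
    unfolding monoid_algebra_mult_def sh_def bilin_extend_def lin_extend_sum lin_extend_basis
  proof (rule sum.cong[OF refl])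
    fix \<xi> assume "\<xi> \<in> shuffles_perm n m"
    then have "\<xi> permutes {1..n + m}" by (rule shuffles_perm_permutes)
    then show "(if ubp_degree (ubp_perm (n + m) \<xi>) = ubp_degree (ubp_perm (n + m) (perm_cat n \<sigma> \<tau>))
        then basis (ubp_comp (ubp_perm (n + m) \<xi>) (ubp_perm (n + m) (perm_cat n \<sigma> \<tau>))) else 0) =
      basis (ubp_perm (n + m) (\<xi> \<circ> perm_cat n \<sigma> \<tau>))"
      using cat_perm by (simp add: deg ubp_comp_perm del: One_nat_def)
  qed
  also have "\<dots> \<in> perm_submodule"
  proof (rule fscale.subspace_sum[OF subspace_perm_submodule])
    fix \<xi> assume "\<xi> \<in> shuffles_perm n m"
    then have "\<xi> permutes {1..n + m}" by (rule shuffles_perm_permutes)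
    then show "basis (ubp_perm (n + m) (\<xi> \<circ> perm_cat n \<sigma> \<tau>)) \<in> perm_submodule"
      using permutes_compose[OF cat_perm]
      by (intro basis_in_perm_submodule[of _ "n + m"]) (simp add: perm_ubps_def del: One_nat_def)
  qed
  finally show "monoid_algebra_mult (sh (ubp_degree f) (ubp_degree g)) (basis (ubp_cat f g))
      \<in> perm_submodule"
    unfolding f_eq g_eq deg[OF \<sigma>] deg[OF \<tau>] ubp_cat_perm[OF \<sigma> \<tau>] .
qed

text \<open>With a right factor of degree 0 the only shuffle is the identity, and concatenation with
  \<open>ubp_empty\<close> changes nothing.\<close>

lemma ubp_mult_one_right:
  fixes x :: "ubp \<Rightarrow>\<^sub>0 'k::comm_ring_1"
  shows "ubp_mult x ubp_one = x"
proof -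
  have "monoid_algebra_mult (sh (ubp_degree f) (ubp_degree ubp_empty)) (basis (ubp_cat f ubp_empty))
      = (basis f :: ubp \<Rightarrow>\<^sub>0 'k)" for f
    using ubps_degree[of f] ubp_degree_ubps[OF ubp_perm_in_ubps[OF permutes_id]]
    by (simp add: ubp_degree_ubps[OF ubp_empty_in_ubps] ubp_cat_empty sh_def shuffles_perm_0
        monoid_algebra_mult_def ubp_comp_id)
  then show ?thesis
    by (simp add: ubp_mult_def ubp_one_def bilin_extend_def lin_extend_basis_id)
qed

lemma ubp_comult_basis:
  "ubp_comult (basis f) = (\<Sum>i\<in>breaking_points f. basis (ubp_split f i))"
  by (simp add: ubp_comult_def tensor_basis)

lemma breaking_point_split_perm:
  assumes \<sigma>: "\<sigma> permutes {1..n}" and i: "i \<in> breaking_points (ubp_perm n \<sigma>)"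
  shows "i \<le> n" "fst (ubp_split (ubp_perm n \<sigma>) i) \<in> perm_ubps i"
    "snd (ubp_split (ubp_perm n \<sigma>) i) \<in> perm_ubps (n - i)"
proof -
  show "i \<le> n"
    using i ubp_degree_ubps[OF ubp_perm_in_ubps[OF \<sigma>]] by (simp add: breaking_points_def)
  then have "i + (n - i) = n" by simp
  then show "fst (ubp_split (ubp_perm n \<sigma>) i) \<in> perm_ubps i"
    "snd (ubp_split (ubp_perm n \<sigma>) i) \<in> perm_ubps (n - i)"
    using ubp_split_perm[of \<sigma> i "n - i"] \<sigma> by simp_all
qed

lemma ubp_comult_perm_submodule:
  assumes x: "x \<in> perm_submodule"
  shows "ubp_comult x \<in> fscale.span {tensor y z | y z. y \<in> perm_submodule \<and> z \<in> perm_submodule}"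
  unfolding ubp_comult_def
proof (rule lin_extend_in_subspace[OF fscale.subspace_span])
  fix f assume "f \<in> Poly_Mapping.keys x"
  then obtain n \<sigma> where \<sigma>: "\<sigma> permutes {1..n}" and f: "f = ubp_perm n \<sigma>"
    by (rule keys_perm_submodule[OF x])
  show "(\<Sum>i\<in>breaking_points f. tensor (basis (fst (ubp_split f i))) (basis (snd (ubp_split f i))))
      \<in> fscale.span {tensor y z | y z. y \<in> perm_submodule \<and> z \<in> perm_submodule}"
    using breaking_point_split_perm[OF \<sigma>] unfolding f
    by (intro fscale.span_sum fscale.span_base) (blast intro: basis_in_perm_submodule)
qed

lemma ubp_one_in_perm_submodule: "ubp_one \<in> perm_submodule"
  unfolding ubp_one_def
  by (rule basis_in_perm_submodule[of _ 0])
    (auto simp: perm_ubps_def ubp_perm_0[symmetric] simp del: permutes_empty)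

lemma subbialgebra_perm_submodule: "subbialgebra ubp_mult ubp_one ubp_comult perm_submodule"
  by (simp add: subbialgebra_def subspace_perm_submodule ubp_one_in_perm_submodule
      ubp_mult_perm_submodule ubp_comult_perm_submodule)

section \<open>Stability under the antipode\<close>

lemma antipode_basis_perm:
  fixes A :: "(ubp \<Rightarrow>\<^sub>0 'k::comm_ring_1) \<Rightarrow> (ubp \<Rightarrow>\<^sub>0 'k)"
  assumes A: "is_antipode ubp_mult ubp_one ubp_comult ubp_counit A"
  shows "f \<in> perm_ubps n \<Longrightarrow> A (basis f) \<in> perm_submodule"
proof (induction n arbitrary: f rule: less_induct)
  case (less n)
  then obtain \<sigma> where \<sigma>: "\<sigma> permutes {1..n}" and f: "f = ubp_perm n \<sigma>"
    by (auto simp: perm_ubps_def)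
  have fn: "f \<in> ubps n" using \<sigma> f by (simp add: ubp_perm_in_ubps)
  let ?t = "\<lambda>i. ubp_mult (A (basis (fst (ubp_split f i)))) (basis (snd (ubp_split f i)))"
  have "fscale (ubp_counit (basis f)) ubp_one = convolution ubp_mult ubp_comult A id (basis f)"
    using A by (simp add: is_antipode_def)
  also have "\<dots> = (\<Sum>i\<in>breaking_points f. ?t i)"
    by (simp add: convolution_def ubp_comult_basis lin_extend_sum case_prod_beta)
  \<comment> \<open>The breaking point \<open>n\<close> contributes \<open>A (basis f)\<close> times
    the unit, so the antipode identity can be solved for \<open>A (basis f)\<close>.\<close>
  also have "\<dots> = ?t n + (\<Sum>i\<in>breaking_points f - {n}. ?t i)"
    by (rule sum.remove) (simp_all add: degree_in_breaking_points[OF fn])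
  also have "?t n = A (basis f)"
    using ubp_mult_one_right by (simp add: ubp_split_degree[OF fn] ubp_one_def)
  finally have Af: "A (basis f) =
      fscale (ubp_counit (basis f)) ubp_one - (\<Sum>i\<in>breaking_points f - {n}. ?t i)"
    by (simp add: algebra_simps)
  \<comment> \<open>Every remaining breaking point is below \<open>n\<close>: the induction
    hypothesis covers the left factor, and the right factor is a permutation.\<close>
  have t: "?t i \<in> perm_submodule" if "i \<in> breaking_points f - {n}" for i
  proof -
    have i: "i \<in> breaking_points (ubp_perm n \<sigma>)" "i \<noteq> n" using that f by auto
    note split = breaking_point_split_perm[OF \<sigma> i(1), folded f]
    have "i < n" using split(1) i(2) by simp
    then show ?thesis
      by (intro ubp_mult_perm_submodule less.IH[OF _ split(2)] basis_in_perm_submodule[OF split(3)])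
  qed
  show ?case
    unfolding Af
    by (intro fscale.subspace_diff fscale.subspace_scale fscale.subspace_sum subspace_perm_submodule
        ubp_one_in_perm_submodule t)
qed

lemma antipode_perm_submodule:
  assumes A: "is_antipode ubp_mult ubp_one ubp_comult ubp_counit A"
    and x: "x \<in> perm_submodule"
  shows "A x \<in> perm_submodule"
proof -
  interpret A: module_hom fscale fscale A using A by (simp add: is_antipode_def)
  have "A ` (\<Union>n. basis ` perm_ubps n) \<subseteq> perm_submodule"
    using antipode_basis_perm[OF A] by blast
  then have "fscale.span (A ` (\<Union>n. basis ` perm_ubps n)) \<subseteq> perm_submodule"
    by (intro fscale.span_minimal subspace_perm_submodule)
  then show ?thesis using x by (auto simp: perm_submodule_def A.span_image)
qed

text \<open>The antipode enters through its defining identities instead of a construction, so the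
  second conjunct ranges over every map \<open>A\<close> satisfying
  \<open>is_antipode\<close>.\<close>

theorem proposition2p4:
  shows "subbialgebra ubp_mult ubp_one ubp_comult (perm_submodule :: (ubp \<Rightarrow>\<^sub>0 'k::comm_ring_1) set) \<and>
    (\<forall>A. is_antipode ubp_mult ubp_one ubp_comult ubp_counit A \<longrightarrow>
      hopf_subalgebra ubp_mult ubp_one ubp_comult A (perm_submodule :: (ubp \<Rightarrow>\<^sub>0 'k) set))"
  using subbialgebra_perm_submodule antipode_perm_submodule
  by (auto simp: hopf_subalgebra_def)

end
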